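(* For the game Euclid, the remoteness value $\mathcal{R}(x,y)$ of a position $(x,y)$ can be computed in time linear in $\log(xy)$.
   Context: Game Euclid: positions are pairs $(x,y)$ of positive integers; $(x,y)$ is terminal iff $x=y$. Otherwise, with $x>y$ say, a move is $(x,y)\to(x-\ell y,y)$ for any integer $\ell>0$ with $x-\ell y>0$ (symmetrically if $y>x$). A player unable to move loses. Remoteness function: $\mathcal{R}(p)=0$ if $p$ is terminal; otherwise, if some move $p\to q$ has $\mathcal{R}(q)$ even, $\mathcal{R}(p)=1+\min\{\mathcal{R}(q): p\to q,\ \mathcal{R}(q)\text{ even}\}$, else $\mathcal{R}(p)=1+\max\{\mathcal{R}(q): p\to q\}$. *)

theory Defs
  imports Complex_Main
begin

text \<open>
  Positions of the game Euclid are pairs of positive integers. The conjuncts \<open>0 < x\<close>, \<open>0 < y\<close>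
  keep pairs with a zero entry, which are not positions, free of moves. Over the naturals the
  side condition \<open>x - l * y > 0\<close> has to be written \<open>l * y < x\<close>; it forces \<open>y < x\<close>.
\<close>

definition euclid_moves :: "nat \<times> nat \<Rightarrow> (nat \<times> nat) set" where
  "euclid_moves p = (case p of (x, y) \<Rightarrow>
     {q. 0 < x \<and> 0 < y \<and>
         ((\<exists>l>0. l * y < x \<and> q = (x - l * y, y)) \<or> (\<exists>l>0. l * x < y \<and> q = (x, y - l * x)))})"

definition euclid_terminal :: "nat \<times> nat \<Rightarrow> bool" where
  "euclid_terminal p \<longleftrightarrow> fst p = snd p"

lemma euclid_moves_decreasing: "q \<in> euclid_moves p \<Longrightarrow> fst q + snd q < fst p + snd p"
  by (auto simp: euclid_moves_def split: prod.splits)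

lemma euclid_moves_positive: "(x', y') \<in> euclid_moves p \<Longrightarrow> 0 < x' \<and> 0 < y'"
  by (auto simp: euclid_moves_def split: prod.splits)

lemma finite_euclid_moves: "finite (euclid_moves p)"
proof (rule finite_subset)
  show "euclid_moves p \<subseteq> {..fst p} \<times> {..snd p}"
    by (auto simp: euclid_moves_def split: prod.splits)
qed simp

lemma euclid_terminal_iff_no_moves:
  assumes "0 < x" "0 < y"
  shows "euclid_terminal (x, y) \<longleftrightarrow> euclid_moves (x, y) = {}"
proof
  assume "euclid_terminal (x, y)"
  then show "euclid_moves (x, y) = {}"
    by (auto simp: euclid_terminal_def euclid_moves_def)
next
  assume none: "euclid_moves (x, y) = {}"
  have "(x - 1 * y, y) \<in> euclid_moves (x, y)" if "y < x"
    using that assms by (auto simp: euclid_moves_def intro: exI[of _ "1::nat"])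
  moreover have "(x, y - 1 * x) \<in> euclid_moves (x, y)" if "x < y"
    using that assms by (auto simp: euclid_moves_def intro: exI[of _ "1::nat"])
  ultimately show "euclid_terminal (x, y)"
    using none by (auto simp: euclid_terminal_def intro: linorder_cases[of x y])
qed

function remoteness :: "nat \<times> nat \<Rightarrow> nat" where
  "remoteness p =
     (if euclid_terminal p then 0
      else let V = remoteness ` euclid_moves p
           in if \<exists>v\<in>V. even v then 1 + Min {v \<in> V. even v} else 1 + Max V)"
  by pat_completeness auto
termination
  by (relation "measure (\<lambda>p. fst p + snd p)") (auto dest: euclid_moves_decreasing)

declare remoteness.simps [simp del]

text \<open>
  Time is measured on a random access machine in the style of Cook and Reckhow, with unit cost:
  one time step per executed instruction. Registers hold natural numbers; subtraction is
  truncated. Quotient and remainder are primitive, so that a division step of the Euclidean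
  algorithm costs a constant. There is deliberately no multiplication: only \<open>Add\<close> can exceed
  the largest number present so far (in the registers or the program), and it at most doubles
  it. Hence \<open>t\<close> steps produce only numbers that are \<open>t\<close> bits longer than the input, up to a constant
  depending on the program, and the unit cost measure cannot hide arithmetic on huge numbers.
\<close>

datatype instr =
    Const nat nat          \<comment> \<open>\<open>R[i] := c\<close>\<close>
  | Add nat nat nat        \<comment> \<open>\<open>R[i] := R[j] + R[k]\<close>\<close>
  | Sub nat nat nat        \<comment> \<open>\<open>R[i] := R[j] - R[k]\<close>\<close>
  | Quot nat nat nat       \<comment> \<open>\<open>R[i] := R[j] div R[k]\<close>\<close>
  | Rem nat nat nat        \<comment> \<open>\<open>R[i] := R[j] mod R[k]\<close>\<close>
  | Load nat nat           \<comment> \<open>\<open>R[i] := R[R[j]]\<close>\<close>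
  | Store nat nat          \<comment> \<open>\<open>R[R[i]] := R[j]\<close>\<close>
  | JumpPos nat nat        \<comment> \<open>\<open>if R[i] > 0 then goto m\<close>\<close>

type_synonym program = "instr list"

type_synonym config = "nat \<times> (nat \<Rightarrow> nat)"  \<comment> \<open>program counter and registers\<close>

fun exec :: "instr \<Rightarrow> config \<Rightarrow> config" where
  "exec (Const i c) (pc, R) = (Suc pc, R(i := c))"
| "exec (Add i j k) (pc, R) = (Suc pc, R(i := R j + R k))"
| "exec (Sub i j k) (pc, R) = (Suc pc, R(i := R j - R k))"
| "exec (Quot i j k) (pc, R) = (Suc pc, R(i := R j div R k))"
| "exec (Rem i j k) (pc, R) = (Suc pc, R(i := R j mod R k))"
| "exec (Load i j) (pc, R) = (Suc pc, R(i := R (R j)))"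
| "exec (Store i j) (pc, R) = (Suc pc, R(R i := R j))"
| "exec (JumpPos i m) (pc, R) = (if R i > 0 then m else Suc pc, R)"

text \<open>The machine halts when the program counter leaves the program.\<close>

definition halted :: "program \<Rightarrow> config \<Rightarrow> bool" where
  "halted P c \<longleftrightarrow> length P \<le> fst c"

definition step :: "program \<Rightarrow> config \<Rightarrow> config" where
  "step P c = (if halted P c then c else exec (P ! fst c) c)"

text \<open>The arguments are in registers 0 and 1 at the start, all other registers being 0.\<close>

definition initial :: "nat \<Rightarrow> nat \<Rightarrow> config" where
  "initial x y = (0, (\<lambda>_. 0)(0 := x, 1 := y))"

text \<open>
  Program \<open>P\<close>, started on \<open>x\<close>, \<open>y\<close>, halts after at most \<open>t\<close> steps with \<open>z\<close> in register 0
  (\<open>step\<close> leaves halted configurations unchanged).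
\<close>

definition outputs_within :: "program \<Rightarrow> nat \<Rightarrow> nat \<Rightarrow> nat \<Rightarrow> nat \<Rightarrow> bool" where
  "outputs_within P x y t z \<longleftrightarrow>
     (let c = (step P ^^ t) (initial x y) in halted P c \<and> snd c 0 = z)"

end

(* Write a position as (k y + r, y) with 0 < r <= y and let v be the remoteness of (r, y). For k > 0
   its remoteness is v + 1 if v is even or k = 1, and v + 2 otherwise. So along the Euclidean
   algorithm the remoteness of the starting position exceeds that of the current one by an amount
   that depends only on the parity of the latter. The machine runs the Euclidean algorithm and
   updates the two possible amounts, which takes no stack; every division step at least halves
   the product of the two numbers. *)

theory Submission
  imports Defs
begin

section \<open>A recursion for the remoteness\<close>

lemma euclid_moves_swap: "euclid_moves (y, x) = prod.swap ` euclid_moves (x, y)"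
  by (auto simp: euclid_moves_def image_iff)

lemma remoteness_swap: "remoteness (y, x) = remoteness (x, y)"
proof (induction "x + y" arbitrary: x y rule: less_induct)
  case less
  have "remoteness (prod.swap q) = remoteness q" if "q \<in> euclid_moves (x, y)" for q
    using less[of "fst q" "snd q"] euclid_moves_decreasing[OF that]
    by (cases q) auto
  then have "remoteness ` euclid_moves (y, x) = remoteness ` euclid_moves (x, y)"
    by (simp add: euclid_moves_swap[of y x] image_image)
  moreover have "euclid_terminal (y, x) \<longleftrightarrow> euclid_terminal (x, y)"
    by (auto simp: euclid_terminal_def)
  ultimately show ?case
    by (simp only: remoteness.simps[of "(x, y)"] remoteness.simps[of "(y, x)"])
qed

text \<open>The first entry exceeds \<open>y\<close>, so only it can be reduced. Since entries of
  positions are positive, the remainder ranges over \<open>0 < r \<le> y\<close>; proper multiples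
  of \<open>y\<close> have \<open>r = y\<close>.\<close>

lemma euclid_moves_multiple_add:
  assumes "0 < r" "r \<le> y" "0 < k"
  shows "euclid_moves (k * y + r, y) = (\<lambda>j. (j * y + r, y)) ` {..<k}"
proof (intro equalityI subsetI)
  fix q assume "q \<in> euclid_moves (k * y + r, y)"
  moreover have "y \<le> k * y"
    using assms by simp
  then have "\<not> l * (k * y + r) < y" if "0 < l" for l
  proof -
    have "y \<le> k * y + r"
      using \<open>y \<le> k * y\<close> by linarith
    also have "\<dots> \<le> l * (k * y + r)"
      using that by simp
    finally show ?thesis
      by (simp only: not_less)
  qed
  ultimately obtain l where l: "0 < l" "l * y < k * y + r" "q = (k * y + r - l * y, y)"
    by (auto simp: euclid_moves_def)
  have "l \<le> k"
  proof (rule ccontr)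
    assume "\<not> l \<le> k"
    then have "Suc k * y \<le> l * y"
      by (intro mult_le_mono1) simp
    then show False
      using l assms by simp
  qed
  then have "q = ((k - l) * y + r, y)" "k - l \<in> {..<k}"
    using l assms by (auto simp: diff_mult_distrib)
  then show "q \<in> (\<lambda>j. (j * y + r, y)) ` {..<k}"
    by blast
next
  fix q assume "q \<in> (\<lambda>j. (j * y + r, y)) ` {..<k}"
  then obtain j where j: "j < k" "q = (j * y + r, y)"
    by auto
  have "(k - j) * y < k * y + r" "k * y + r - (k - j) * y = j * y + r"
    using j assms by (auto simp: diff_mult_distrib)
  then show "q \<in> euclid_moves (k * y + r, y)"
    using j assms by (auto simp: euclid_moves_def intro!: exI[of _ "k - j"])
qed

text \<open>Meant for \<open>k > 0\<close> only: for \<open>k = 0\<close> the remoteness is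
  \<open>v\<close> itself.\<close>

definition remoteness_increment :: "nat \<Rightarrow> nat \<Rightarrow> nat" where
  "remoteness_increment k v = (if even v \<or> k = 1 then 1 else 2)"

text \<open>Strong induction gives the values of all options. If \<open>v\<close> is even, the
  options other than \<open>v\<close> have the odd value \<open>v + 1\<close>. If \<open>v\<close>
  is odd, it is the only option for \<open>k = 1\<close>; for larger \<open>k\<close> the sole even
  value is \<open>v + 1\<close>, reached at \<open>j = 1\<close>.\<close>

lemma remoteness_multiple_add:
  assumes "0 < r" "r \<le> y" "0 < k"
  shows "remoteness (k * y + r, y) =
    remoteness (r, y) + remoteness_increment k (remoteness (r, y))"
  using \<open>0 < k\<close>
proof (induction k rule: less_induct)
  case (less k)
  define v where "v = remoteness (r, y)"
  define V where "V = remoteness ` euclid_moves (k * y + r, y)"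
  have V: "V = (\<lambda>j. if j = 0 then v else v + remoteness_increment j v) ` {..<k}"
    unfolding V_def euclid_moves_multiple_add[OF assms(1,2) less.prems] image_image
    using less.IH by (intro image_cong) (auto simp: v_def)
  have "y \<le> k * y"
    using less.prems by simp
  then have "y < k * y + r"
    using assms by linarith
  then have "\<not> euclid_terminal (k * y + r, y)"
    by (simp add: euclid_terminal_def)
  then have rem: "remoteness (k * y + r, y) =
      (if \<exists>w\<in>V. even w then 1 + Min {w \<in> V. even w} else 1 + Max V)"
    by (subst remoteness.simps) (simp add: V_def Let_def)
  have v: "v \<in> V"
    using less.prems by (auto simp: V intro!: image_eqI[of _ _ 0])
  consider "even v" | "odd v" "k = 1" | "odd v" "1 < k"
    using less.prems by linarith
  then show ?case
  proof cases
    case 1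
    then have "{w \<in> V. even w} = {v}"
      using v by (auto simp: V remoteness_increment_def)
    then have "remoteness (k * y + r, y) = v + 1"
      using rem v 1 by auto
    then show ?thesis
      using 1 by (simp add: v_def remoteness_increment_def)
  next
    case 2
    then have "V = {v}"
      by (auto simp: V)
    then have "remoteness (k * y + r, y) = v + 1"
      using rem 2 by auto
    then show ?thesis
      using 2 by (simp add: v_def remoteness_increment_def)
  next
    case 3
    have v1: "v + 1 \<in> V"
      using 3 by (auto simp: V remoteness_increment_def intro!: image_eqI[of _ _ 1])
    then have "{w \<in> V. even w} = {v + 1}"
      using 3 by (auto simp: V remoteness_increment_def split: if_splits)
    moreover have "\<exists>w\<in>V. even w"
      using v1 3 by (intro bexI[of _ "v + 1"]) auto
    ultimately have "remoteness (k * y + r, y) = v + 2"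
      using rem by simp
    then show ?thesis
      using 3 by (simp add: v_def remoteness_increment_def)
  qed
qed

lemma remoteness_diagonal: "remoteness (x, x) = 0"
  by (simp add: remoteness.simps euclid_terminal_def)

lemma remoteness_proper_multiple:
  assumes "0 < y" "1 < k"
  shows "remoteness (k * y, y) = 1"
  \<comment> \<open>With \<open>r = y\<close> the multiplier is \<open>k - 1\<close>, and the base
    position is terminal, so \<open>v = 0\<close> is even.\<close>
  using remoteness_multiple_add[of y y "k - 1"] assms
  by (simp add: remoteness_diagonal remoteness_increment_def diff_mult_distrib)

lemma remoteness_Euclid_step:
  assumes "0 < y" "y \<le> x" "0 < x mod y"
  shows "remoteness (x, y) = remoteness (y, x mod y) +
    remoteness_increment (x div y) (remoteness (y, x mod y))"
  using remoteness_multiple_add[of "x mod y" y "x div y"] assms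
  by (simp add: remoteness_swap[of y] div_greater_zero_iff less_imp_le)

section \<open>The machine\<close>

text \<open>
  Registers 0 and 1 hold the current pair, with the larger entry first. Registers 2 and 3 hold
  the amount to be added to its remoteness if that is even or odd, respectively.
  Registers 6 and 8 hold the constants 1 and 0.
\<close>

definition euclid_program :: program where
  "euclid_program =
    [Const 6 1, Sub 4 0 1, Sub 5 1 0, Sub 1 0 4, Add 0 0 5,
     \<comment> \<open>5: division step\<close>
     Quot 4 0 1, Rem 5 0 1, Sub 7 4 6, JumpPos 5 14,
     \<comment> \<open>9: remainder 0\<close>
     JumpPos 7 12, Add 0 2 8, JumpPos 6 23, Add 0 3 6, JumpPos 6 23,
     \<comment> \<open>14: positive remainder\<close>
     Add 9 3 6, JumpPos 7 18, Add 3 2 6, JumpPos 6 19, Add 3 9 6,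
     Add 2 9 8, Add 0 1 8, Add 1 5 8, JumpPos 6 5]"

lemma step_euclid_program:
  "pc < 23 \<Longrightarrow> step euclid_program (pc, R) = exec (euclid_program ! pc) (pc, R)"
  by (simp add: step_def halted_def euclid_program_def)

lemma step_euclid_program_halted: "step euclid_program (23, R) = (23, R)"
  by (simp add: step_def halted_def euclid_program_def)

text \<open>Exposes the first step of a run, so that simplification executes it forwards.\<close>

lemma funpow_numeral_apply: "(f ^^ numeral k) x = (f ^^ pred_numeral k) (f x)"
  by (simp add: numeral_eq_Suc funpow_swap1)

text \<open>Unfolds the program only where an instruction is fetched.\<close>

lemmas euclid_program_nth = arg_cong[OF euclid_program_def, of "\<lambda>P. P ! pc" for pc]

lemmas run_simps = step_euclid_program step_euclid_program_halted
  funpow_numeral_apply euclid_program_nth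

definition loop_invariant :: "(nat \<Rightarrow> nat) \<Rightarrow> bool" where
  "loop_invariant R \<longleftrightarrow> 0 < R 1 \<and> R 1 \<le> R 0 \<and> R 6 = 1 \<and> R 8 = 0"

text \<open>The quantity preserved by the loop: the remoteness of the input, reconstructed from the
  current pair.\<close>

definition loop_result :: "(nat \<Rightarrow> nat) \<Rightarrow> nat" where
  "loop_result R = (let v = remoteness (R 0, R 1) in v + (if even v then R 2 else R 3))"

text \<open>Truncated subtraction yields maximum and minimum without branching:
  \<open>x + (y - x)\<close> and \<open>x - (x - y)\<close>. Registers 2 and 3 start at 0, as
  nothing has to be added yet.\<close>

lemma run_prefix:
  assumes "0 < x" "0 < y"
  obtains R where "(step euclid_program ^^ 5) (initial x y) = (5, R)" "loop_invariant R"
    "R 0 * R 1 = x * y" "loop_result R = remoteness (x, y)"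
proof -
  obtain R where R: "(step euclid_program ^^ 5) (initial x y) = (5, R)"
    "R 0 = x + (y - x)" "R 1 = x - (x - y)" "R 2 = 0" "R 3 = 0" "R 6 = 1" "R 8 = 0"
    by (simp add: run_simps initial_def)
  show thesis
  proof (rule that[OF R(1)])
    show "loop_invariant R"
      using R assms by (simp add: loop_invariant_def)
    show "R 0 * R 1 = x * y" "loop_result R = remoteness (x, y)"
      using R remoteness_swap[of x y]
      by (cases "x \<le> y"; simp add: loop_result_def Let_def mult.commute)+
  qed
qed

text \<open>The last pair has remoteness 1 if the quotient exceeds 1 and remoteness 0 if the entries
  are equal; this parity selects register 3 or 2. Both branches take seven steps.\<close>

lemma run_last_division:
  assumes "loop_invariant R" "R 0 mod R 1 = 0"
  obtains R' where "(step euclid_program ^^ 7) (5, R) = (23, R')" "R' 0 = loop_result R"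
proof (cases "1 < R 0 div R 1")
  case True
  have "R 0 = R 0 div R 1 * R 1"
    using assms(2) by (simp add: mod_0_imp_dvd)
  then have "loop_result R = 1 + R 3"
    using remoteness_proper_multiple[of "R 1" "R 0 div R 1"] True assms
    by (simp add: loop_result_def loop_invariant_def)
  then show thesis
    using that True assms by (simp add: run_simps loop_invariant_def)
next
  case False
  have "0 < R 0 div R 1"
    using assms by (simp add: loop_invariant_def div_greater_zero_iff)
  with False have div: "R 0 div R 1 = 1"
    by linarith
  then have "R 0 = R 1"
    using div_mult_mod_eq[of "R 0" "R 1"] assms by simp
  then have "loop_result R = R 2"
    by (simp add: loop_result_def remoteness_diagonal)
  then show thesis
    using that div assms by (simp add: run_simps loop_invariant_def)
qed

text \<open>The remoteness of a pair exceeds that of its successor by 1 or 2. An excess of 1 flips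
  the parity and so exchanges the roles of registers 2 and 3; an excess of 2, for an odd successor
  and quotient above 1, keeps it.\<close>

lemma run_division:
  assumes "loop_invariant R" "0 < R 0 mod R 1"
  obtains t R' where "t \<le> 12" "(step euclid_program ^^ t) (5, R) = (5, R')" "loop_invariant R'"
    "R' 0 = R 1" "R' 1 = R 0 mod R 1" "loop_result R' = loop_result R"
proof -
  \<comment> \<open>The branch for quotient 1 has one more instruction, the jump over
    \<open>Add 3 9 6\<close>.\<close>
  define t where "t = (if 1 < R 0 div R 1 then 11 else 12 :: nat)"
  have "\<exists>R'. (step euclid_program ^^ t) (5, R) = (5, R') \<and> R' 0 = R 1 \<and> R' 1 = R 0 mod R 1 \<and>
      R' 2 = R 3 + 1 \<and> R' 3 = (if 1 < R 0 div R 1 then R 3 + 2 else R 2 + 1) \<and> R' 6 = 1 \<and> R' 8 = 0"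
    using assms
    by (cases "1 < R 0 div R 1"; simp add: run_simps loop_invariant_def t_def)
  then obtain R' where run: "(step euclid_program ^^ t) (5, R) = (5, R')"
    and R': "R' 0 = R 1" "R' 1 = R 0 mod R 1" "R' 2 = R 3 + 1"
      "R' 3 = (if 1 < R 0 div R 1 then R 3 + 2 else R 2 + 1)" "R' 6 = 1" "R' 8 = 0"
    by blast
  have "t \<le> 12"
    by (simp add: t_def)
  show thesis
  proof (rule that[OF \<open>t \<le> 12\<close> run])
    show "loop_invariant R'"
      using R' assms by (simp add: loop_invariant_def less_imp_le)
    have "0 < R 0 div R 1"
      using assms by (simp add: loop_invariant_def div_greater_zero_iff)
    then show "loop_result R' = loop_result R"
      using remoteness_Euclid_step[of "R 1" "R 0"] assms R'
      by (auto simp: loop_result_def loop_invariant_def remoteness_increment_def Let_def)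
  qed (use R' in simp_all)
qed

section \<open>Halving of the product and the logarithmic time bound\<close>

lemma twice_mult_mod_le:
  fixes a b :: nat
  assumes "0 < b" "b \<le> a"
  shows "2 * (b * (a mod b)) \<le> a * b"
proof -
  \<comment> \<open>The quotient is at least 1, so
    \<open>a \<ge> b + a mod b \<ge> 2 * (a mod b)\<close>.\<close>
  have "1 * b \<le> a div b * b"
    using assms by (intro mult_le_mono1) (simp add: Suc_le_eq div_greater_zero_iff)
  then have "b + a mod b \<le> a div b * b + a mod b"
    by (simp only: mult_1 add_le_mono1)
  then have "2 * (a mod b) \<le> a"
    using mod_less_divisor[OF assms(1), of a] by (simp only: div_mult_mod_eq)
  then show ?thesis
    using mult_le_mono1[of "2 * (a mod b)" a b] by (simp add: ac_simps)
qed

text \<open>The binary logarithm of the product is a potential: halving lowers it by at least 1,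
  which pays for the at most 12 steps of a division. The 7 pays for the last one.\<close>

lemma run_loop:
  assumes "loop_invariant R"
  shows "\<exists>t R'. real t \<le> 12 * log 2 (real (R 0 * R 1)) + 7 \<and>
    (step euclid_program ^^ t) (5, R) = (23, R') \<and> R' 0 = loop_result R"
  using assms
proof (induction "R 1" arbitrary: R rule: less_induct)
  case less
  have pos: "0 < R 1" "R 1 \<le> R 0"
    using less.prems by (simp_all add: loop_invariant_def)
  then have "0 < R 0 * R 1"
    by simp
  then have log_nonneg: "0 \<le> log 2 (real (R 0 * R 1))"
    by (subst zero_le_log_cancel_iff) linarith+
  show ?case
  proof (cases "R 0 mod R 1 = 0")
    case True
    from run_last_division[OF less.prems True] obtain R' where
      "(step euclid_program ^^ 7) (5, R) = (23, R')" "R' 0 = loop_result R" .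
    then show ?thesis
      using log_nonneg by (intro exI[of _ 7] exI[of _ R']) simp
  next
    case False
    then have "0 < R 0 mod R 1"
      by simp
    from run_division[OF less.prems this] obtain s S where S: "s \<le> 12"
      "(step euclid_program ^^ s) (5, R) = (5, S)" "loop_invariant S"
      "S 0 = R 1" "S 1 = R 0 mod R 1" "loop_result S = loop_result R" .
    have "S 1 < R 1"
      using S pos by simp
    from less.hyps[OF this S(3)] obtain t R' where t:
      "real t \<le> 12 * log 2 (real (S 0 * S 1)) + 7"
      "(step euclid_program ^^ t) (5, S) = (23, R')" "R' 0 = loop_result R"
      using S(6) by auto
    have "2 * (S 0 * S 1) \<le> R 0 * R 1"
      using twice_mult_mod_le[OF pos] S by simp
    then have le: "2 * real (S 0 * S 1) \<le> real (R 0 * R 1)"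
      by (metis of_nat_le_iff of_nat_mult of_nat_numeral)
    have "0 < real (S 0 * S 1)"
      using S by (simp add: loop_invariant_def)
    then have "1 + log 2 (real (S 0 * S 1)) = log 2 (2 * real (S 0 * S 1))"
      by (simp only: log_mult_pos) simp
    also have "\<dots> \<le> log 2 (real (R 0 * R 1))"
      using le \<open>0 < real (S 0 * S 1)\<close> by (intro log_mono) linarith+
    finally have "real (t + s) \<le> 12 * log 2 (real (R 0 * R 1)) + 7"
      using t(1) S(1) by simp
    moreover have "(step euclid_program ^^ (t + s)) (5, R) = (23, R')"
      using S(2) t(2) by (simp add: funpow_add)
    ultimately show ?thesis
      using t(3) by blast
  qed
qed

theorem mainTheorem11:
  "\<exists>(P :: program) (C :: real) (D :: real). \<forall>(x :: nat) (y :: nat). 0 < x \<longrightarrow> 0 < y \<longrightarrow>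
     (\<exists>t :: nat. real t \<le> C * log 2 (real (x * y)) + D \<and>
        outputs_within P x y t (remoteness (x, y)))"
\<comment> \<open>The value 12 serves twice: as \<open>C\<close> it bounds a division step, as
  \<open>D\<close> it is 5 steps of prefix plus 7 of the last division.\<close>
proof (intro exI[of _ euclid_program] exI[of _ "12 :: real"] allI impI)
  fix x y :: nat
  assume "0 < x" "0 < y"
  from run_prefix[OF this] obtain R where R:
    "(step euclid_program ^^ 5) (initial x y) = (5, R)" "loop_invariant R"
    "R 0 * R 1 = x * y" "loop_result R = remoteness (x, y)" .
  from run_loop[OF R(2)] obtain t R' where t:
    "real t \<le> 12 * log 2 (real (x * y)) + 7"
    "(step euclid_program ^^ t) (5, R) = (23, R')" "R' 0 = remoteness (x, y)"
    unfolding R(3,4) by blast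
  have "(step euclid_program ^^ (t + 5)) (initial x y) = (23, R')"
    using R(1) t(2) by (simp only: funpow_add o_apply)
  moreover have "halted euclid_program (23, R')"
    by (simp add: halted_def euclid_program_def)
  ultimately have "outputs_within euclid_program x y (t + 5) (remoteness (x, y))"
    using t(3) by (simp only: outputs_within_def Let_def snd_conv simp_thms)
  moreover have "real (t + 5) \<le> 12 * log 2 (real (x * y)) + 12"
    using t(1) by simp
  ultimately show "\<exists>t. real t \<le> 12 * log 2 (real (x * y)) + 12 \<and>
      outputs_within euclid_program x y t (remoteness (x, y))"
    by blast
qed

end
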